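(* For $N\in\mathbb{N}$ let $(p_t^N)_{t\ge0}$ be the transition function on $(\mathbb{R}^d)^N$ of a mean-field particle system $(X_t^{i,N})_{t\ge0,\,i=1,\dots,N}$, and let $\bar p_t$ be the transition function of the limiting process $(\bar X_t)_{t\ge0}$ on $\mathbb{R}^d$ (see the context). Let $\mathbf{dist}$ be a distance between probability measures on $(\mathbb{R}^d)^N$ (for each $N$). Assume: (1) (Contractivity for the mean-field particle system) There exist $\lambda>0$ and $C<\infty$, independent of $N$, such that for all probability measures $\nu,\eta$ on $\mathbb{R}^d$, all $t>0$ and all $N\in\mathbb{N}$, $\mathbf{dist}(\nu^{\otimes N}p_t^N,\eta^{\otimes N}p_t^N)\le Ce^{-\lambda t}\,\mathbf{dist}(\nu^{\otimes N},\eta^{\otimes N})$. (2) (Finite time propagation of chaos) There exist a time $\tau>0$, a constant $\alpha>0$ and a function $\mathbf{M}:\mathcal{P}(\mathbb{R}^d)\to[0,\infty)$ such that for all probability measures $\nu$ on $\mathbb{R}^d$ and all $N\in\mathbb{N}$, $\sup_{t\le\tau}\mathbf{dist}(\nu^{\otimes N}p_t^N,(\nu\bar p_t)^{\otimes N})\le N^{-\alpha}\mathbf{M}(\nu)$. (3) (Uniform control for the limit process) For all probability measures $\nu$ on $\mathbb{R}^d$ there exists a constant $\mathbf{C}(\nu)<\infty$ such that $\sup_{t\ge0}\mathbf{M}(\nu\bar p_t)\le\mathbf{C}(\nu)$. Let $\nu$ be a probability measure on $\mathbb{R}^d$. Then there exists a constant $\tilde{\mathbf{C}}>0$ such that for all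 $t\ge0$ and $N\in\mathbb{N}$ $$\mathbf{dist}((\nu\bar p_t)^{\otimes N},\nu^{\otimes N}p_t^N)\le\tilde{\mathbf{C}}\,N^{-\alpha}.$$ Moreover, the constant $\tilde{\mathbf{C}}$ depends on $\lambda$, $C$ and $\mathbf{C}(\nu)$ and is independent of $N\in\mathbb{N}$.
   Context: $\nu^{\otimes N}$ is the $N$-fold product measure and $\mathcal{P}(\mathbb{R}^d)$ the set of probability measures on $\mathbb{R}^d$. The particle system is a time-homogeneous Markov process on $(\mathbb{R}^d)^N$; $\rho p_t^N$ is its law at time $t$ when its initial law is $\rho\in\mathcal{P}((\mathbb{R}^d)^N)$, and $\rho p_s^Np_t^N=\rho p_{s+t}^N$. As $N\to\infty$ each component of the particle system converges to the limiting process in an appropriate sense; $\nu\bar p_t$ denotes the law at time $t$ of the limiting process with initial law $\nu$ (the map $\nu\mapsto\nu\bar p_t$ may be nonlinear), with $(\nu\bar p_s)\bar p_t=\nu\bar p_{s+t}$; $(\nu\bar p_t)^{\otimes N}$ is the law of $N$ i.i.d. copies of it. A typical example is the McKean–Vlasov particle system $\mathrm{d}X_t^{i,N}=b(X_t^{i,N},\mu_{\mathcal{X}_t^N})\,\mathrm{d}t+\sigma(X_t^{i,N},\mu_{\mathcal{X}_t^N})\,\mathrm{d}B_t^i$, where $\mu_{\mathcal{X}_t^N}=\frac1N\sum_{i=1}^N\delta_{X_t^{i,N}}$ and $B^1,\dots,B^N$ are independent standard Brownian motions, with limiting process $\mathrm{d}\bar X_t=b(\bar X_t,\bar\mu_t)\,\mathrm{d}t+\sigma(\bar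 X_t,\bar\mu_t)\,\mathrm{d}B_t$, $\bar\mu_t=\mathrm{Law}(\bar X_t)$.
   Formalization: Contractivity (1) is assumed also when the first initial law is ν^{⊗N}p_s^N (s≥0), not only a product law, since for a general distance the claim fails with (1) for product laws only; the constant may depend also on τ (and d), not only on λ, C and C(ν). *)

theory Defs
  imports "HOL-Probability.Probability"
begin

text \<open>
  Probability measures on a measurable space \<open>E\<close> are the elements of \<^term>\<open>space (prob_algebra E)\<close>.
  A configuration of \<open>N\<close> particles in \<open>\<real>\<^sup>d\<close> is an extensional function on \<open>{1..N}\<close>, because \<open>N\<close> has to
  vary within one statement.
\<close>

definition conf_space :: "nat \<Rightarrow> (nat \<Rightarrow> real ^ 'd) measure" where
  "conf_space N = Pi\<^sub>M {1..N} (\<lambda>_. borel)"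

definition prod_law :: "(real ^ 'd) measure \<Rightarrow> nat \<Rightarrow> (nat \<Rightarrow> real ^ 'd) measure" where
  "prod_law \<nu> N = Pi\<^sub>M {1..N} (\<lambda>_. \<nu>)"

text \<open>
  For a transition function \<open>p\<close>, the law at time \<open>t\<close> of the process with initial law \<open>\<rho>\<close> is
  \<open>\<rho> \<bind> p t\<close>.
\<close>

definition transition_function :: "'a measure \<Rightarrow> (real \<Rightarrow> 'a \<Rightarrow> 'a measure) \<Rightarrow> bool" where
  "transition_function E p \<longleftrightarrow>
     (\<forall>t\<ge>0. p t \<in> E \<rightarrow>\<^sub>M prob_algebra E) \<and>
     (\<forall>x\<in>space E. p 0 x = return E x) \<and>
     (\<forall>s\<ge>0. \<forall>t\<ge>0. \<forall>x\<in>space E. p (s + t) x = p s x \<bind> p t)"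

text \<open>
  The limiting process may be nonlinear in the sense of McKean, so its evolution acts on laws only and
  is not given by a kernel: \<open>q t \<nu>\<close> is the law at time \<open>t\<close> for the initial law \<open>\<nu>\<close>.
\<close>

definition nonlinear_evolution ::
    "'a measure \<Rightarrow> (real \<Rightarrow> 'a measure \<Rightarrow> 'a measure) \<Rightarrow> bool" where
  "nonlinear_evolution E q \<longleftrightarrow>
     (\<forall>t\<ge>0. \<forall>\<nu>\<in>space (prob_algebra E). q t \<nu> \<in> space (prob_algebra E)) \<and>
     (\<forall>\<nu>\<in>space (prob_algebra E). q 0 \<nu> = \<nu>) \<and>
     (\<forall>s\<ge>0. \<forall>t\<ge>0. \<forall>\<nu>\<in>space (prob_algebra E). q t (q s \<nu>) = q (s + t) \<nu>)"

text \<open>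
  For \<open>s = 0\<close> the inequality below is the contraction
  \<open>dist (\<nu>\<^sup>\<otimes>\<^sup>N p\<^sub>t) (\<eta>\<^sup>\<otimes>\<^sup>N p\<^sub>t) \<le> C e\<^sup>-\<^sup>\<lambda>\<^sup>t dist (\<nu>\<^sup>\<otimes>\<^sup>N) (\<eta>\<^sup>\<otimes>\<^sup>N)\<close> between product initial laws. Interaction destroys
  the product form at once, and for an arbitrary metric the contraction at \<open>s = 0\<close> alone says nothing
  about how an error already made is propagated. The first initial law is therefore allowed to be the
  law \<open>\<nu>\<^sup>\<otimes>\<^sup>N p\<^sub>s\<close> of the particle system itself, started from a product law; this is the form in which
  contractivity is combined with the semigroup property to compare particle system and limit.
\<close>

definition particle_contractive ::
    "(nat \<Rightarrow> real \<Rightarrow> (nat \<Rightarrow> real ^ 'd) \<Rightarrow> (nat \<Rightarrow> real ^ 'd) measure) \<Rightarrow>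
     (nat \<Rightarrow> (nat \<Rightarrow> real ^ 'd) measure \<Rightarrow> (nat \<Rightarrow> real ^ 'd) measure \<Rightarrow> real) \<Rightarrow>
     real \<Rightarrow> real \<Rightarrow> bool" where
  "particle_contractive p dst lam C \<longleftrightarrow>
     (\<forall>\<nu>\<in>space (prob_algebra borel). \<forall>\<eta>\<in>space (prob_algebra borel). \<forall>s\<ge>0. \<forall>t>0. \<forall>N\<ge>1.
        dst N ((prod_law \<nu> N \<bind> p N s) \<bind> p N t) (prod_law \<eta> N \<bind> p N t)
          \<le> C * exp (- lam * t) * dst N (prod_law \<nu> N \<bind> p N s) (prod_law \<eta> N))"

definition finite_time_chaos ::
    "(nat \<Rightarrow> real \<Rightarrow> (nat \<Rightarrow> real ^ 'd) \<Rightarrow> (nat \<Rightarrow> real ^ 'd) measure) \<Rightarrow>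
     (real \<Rightarrow> (real ^ 'd) measure \<Rightarrow> (real ^ 'd) measure) \<Rightarrow>
     (nat \<Rightarrow> (nat \<Rightarrow> real ^ 'd) measure \<Rightarrow> (nat \<Rightarrow> real ^ 'd) measure \<Rightarrow> real) \<Rightarrow>
     real \<Rightarrow> real \<Rightarrow> ((real ^ 'd) measure \<Rightarrow> real) \<Rightarrow> bool" where
  "finite_time_chaos p q dst \<tau> \<alpha> M \<longleftrightarrow>
     (\<forall>\<nu>\<in>space (prob_algebra borel). \<forall>N\<ge>1. \<forall>t\<in>{0..\<tau>}.
        dst N (prod_law \<nu> N \<bind> p N t) (prod_law (q t \<nu>) N) \<le> real N powr (- \<alpha>) * M \<nu>)"

end

theory Submission
  imports Defs
begin

text \<open>
  Telescope along the limit: with \<open>\<nu>\<^sub>j\<close> the limit law at time \<open>j\<tau>\<close>, the law \<open>\<nu>\<^sub>j\<^sup>\<otimes>\<^sup>N p\<^sub>\<tau>\<close> is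
  within \<open>N\<^sup>-\<^sup>\<alpha> C(\<nu>)\<close> of \<open>\<nu>\<^sub>j\<^sub>+\<^sub>1\<^sup>\<otimes>\<^sup>N\<close> by finite time chaos, and contractivity damps this
  error exponentially over the remaining time. The errors sum to a geometric series. Contractivity
  is applied to each fresh error only, never iterated, so \<open>C > 1\<close> does no harm.
\<close>

lemma prod_law_in_prob_algebra:
  fixes \<nu> :: "(real ^ 'd) measure"
  assumes "\<nu> \<in> space (prob_algebra borel)"
  shows "prod_law \<nu> N \<in> space (prob_algebra (conf_space N))"
proof -
  have "prob_space \<nu>" "sets \<nu> = sets borel"
    using assms by (auto simp: space_prob_algebra)
  then show ?thesis
    unfolding space_prob_algebra prod_law_def conf_space_def
    by (auto intro!: prob_space_PiM sets_PiM_cong)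
qed

lemma bind_in_prob_algebra:
  assumes "\<rho> \<in> space (prob_algebra E)" "k \<in> E \<rightarrow>\<^sub>M prob_algebra F"
  shows "\<rho> \<bind> k \<in> space (prob_algebra F)"
  using assms prob_space_bind'[of \<rho> E k F] sets_bind'[of \<rho> E k F]
  by (auto simp: space_prob_algebra)

text \<open>Associativity of bind integrates the pointwise Chapman-Kolmogorov identity of
  \<open>transition_function\<close> against the initial law.\<close>

lemma bind_transition_function_add:
  assumes p: "transition_function E p" and \<rho>: "\<rho> \<in> space (prob_algebra E)"
    and s: "s \<ge> 0" and t: "t \<ge> 0"
  shows "\<rho> \<bind> p (s + t) = (\<rho> \<bind> p s) \<bind> p t"
proof -
  have sets: "sets \<rho> = sets E" using \<rho> by (simp add: space_prob_algebra)
  have m: "p u \<in> E \<rightarrow>\<^sub>M subprob_algebra E" if "u \<ge> 0" for u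
    using p that by (auto simp: transition_function_def intro: measurable_prob_algebraD)
  have "(\<rho> \<bind> p s) \<bind> p t = \<rho> \<bind> (\<lambda>x. p s x \<bind> p t)"
    using m[OF s] m[OF t] by (intro bind_assoc) (simp_all add: measurable_cong_sets[OF sets refl])
  also have "\<dots> = \<rho> \<bind> p (s + t)"
    using p s t sets_eq_imp_space_eq[OF sets]
    by (intro bind_cong) (auto simp: transition_function_def)
  finally show ?thesis by simp
qed

text \<open>If t > n\<tau>, the errors made by times \<tau>, ..., n\<tau> still have more than
  (n-1)\<tau>, ..., 0 to run. This gives the n powers of \<open>exp (- lam * \<tau>)\<close>; the
  leading 1 is the undamped error of the last stretch, of length at most \<tau>.\<close>

lemma chaos_by_telescoping:
  fixes p :: "nat \<Rightarrow> real \<Rightarrow> (nat \<Rightarrow> real ^ 'd) \<Rightarrow> (nat \<Rightarrow> real ^ 'd) measure"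
  assumes \<tau>: "\<tau> > 0" and lam: "lam > 0" and N: "N \<ge> 1"
    and p: "transition_function (conf_space N) (p N)"
    and q: "nonlinear_evolution borel q"
    and dst: "Metric_space (space (prob_algebra (conf_space N))) (dst N)"
    and contr: "particle_contractive p dst lam C"
    and chaos: "finite_time_chaos p q dst \<tau> \<alpha> M"
    and \<eta>: "\<eta> \<in> space (prob_algebra borel)"
    and MB: "\<And>u. u \<ge> 0 \<Longrightarrow> M (q u \<eta>) \<le> B"
    and t: "0 \<le> t" "t \<le> real (Suc n) * \<tau>"
  shows "dst N (prod_law \<eta> N \<bind> p N t) (prod_law (q t \<eta>) N)
    \<le> real N powr (- \<alpha>) * B * (1 + \<bar>C\<bar> * (\<Sum>i<n. exp (- lam * \<tau>) ^ i))"
proof -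
  interpret Metric_space "space (prob_algebra (conf_space N))" "dst N" by (fact dst)
  have q_in: "q s \<nu> \<in> space (prob_algebra borel)"
    if "s \<ge> 0" "\<nu> \<in> space (prob_algebra borel)" for s \<nu>
    using q that by (simp add: nonlinear_evolution_def)
  have q_add: "q s (q r \<nu>) = q (r + s) \<nu>"
    if "s \<ge> 0" "r \<ge> 0" "\<nu> \<in> space (prob_algebra borel)" for r s \<nu>
    using q that by (simp add: nonlinear_evolution_def)
  have step_in: "\<rho> \<bind> p N s \<in> space (prob_algebra (conf_space N))"
    if "s \<ge> 0" "\<rho> \<in> space (prob_algebra (conf_space N))" for s \<rho>
    using p that by (auto simp: transition_function_def intro: bind_in_prob_algebra)
  have short: "dst N (prod_law \<nu> N \<bind> p N s) (prod_law (q s \<nu>) N) \<le> real N powr (- \<alpha>) * B"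
    if "\<nu> \<in> space (prob_algebra borel)" "\<And>u. u \<ge> 0 \<Longrightarrow> M (q u \<nu>) \<le> B" "0 \<le> s" "s \<le> \<tau>" for \<nu> s
  proof -
    \<comment> \<open>Time 0 suffices, because \<open>q 0 \<nu> = \<nu>\<close>.\<close>
    have "M \<nu> \<le> B"
      using that(2)[of 0] q that(1) by (simp add: nonlinear_evolution_def)
    then have "real N powr (- \<alpha>) * M \<nu> \<le> real N powr (- \<alpha>) * B"
      by (intro mult_left_mono) auto
    moreover have "dst N (prod_law \<nu> N \<bind> p N s) (prod_law (q s \<nu>) N) \<le> real N powr (- \<alpha>) * M \<nu>"
      using chaos that N by (simp add: finite_time_chaos_def)
    ultimately show ?thesis by linarith
  qed
  \<comment> \<open>At time 0 the quantity bounded in \<open>short\<close> is a distance, so the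
    bound cannot be negative.\<close>
  have B0: "0 \<le> real N powr (- \<alpha>) * B"
    using short[OF \<eta> MB, of 0] \<tau> by (smt (verit) nonneg)
  \<comment> \<open>Restarting at time \<tau> changes both the initial law and the remaining time,
    so the induction generalizes \<open>\<eta>\<close> and \<open>t\<close>.\<close>
  show ?thesis
    using \<eta> MB t
  proof (induction n arbitrary: \<eta> t)
    case 0
    then show ?case using short[of \<eta> t] by simp
  next
    case (Suc n)
    note \<eta> = Suc.prems(1) and MB = Suc.prems(2)
    let ?\<eta>' = "q \<tau> \<eta>" and ?r = "t - \<tau>"
    let ?S = "\<lambda>n. \<Sum>i<n. exp (- lam * \<tau>) ^ i"
    \<comment> \<open>For smaller t only the sum grows. Otherwise the remaining time
      \<open>?r\<close> exceeds n\<tau>: this yields the power n of the decay factor and, being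
      strict, a positive time for contractivity.\<close>
    show ?case
    proof (cases "t \<le> real (Suc n) * \<tau>")
      case True
      have "real N powr (- \<alpha>) * B * (1 + \<bar>C\<bar> * ?S n)
          \<le> real N powr (- \<alpha>) * B * (1 + \<bar>C\<bar> * ?S (Suc n))"
        using B0 by (intro mult_left_mono add_left_mono) auto
      with Suc.IH[OF \<eta> MB Suc.prems(3) True] show ?thesis by linarith
    next
      case False
      then have r: "?r > real n * \<tau>" "?r \<le> real (Suc n) * \<tau>"
        using Suc.prems(4) by (simp_all add: algebra_simps)
      have r0: "?r > 0" using r(1) \<tau> by (smt (verit) of_nat_0_le_iff mult_nonneg_nonneg)
      have \<eta>': "?\<eta>' \<in> space (prob_algebra borel)" using q_in \<eta> \<tau> by simp
      \<comment> \<open>The orbit of \<open>?\<eta>'\<close> is a tail of the orbit of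
        \<open>\<eta>\<close>, so B survives the restart unchanged.\<close>
      have MB': "M (q u ?\<eta>') \<le> B" if "u \<ge> 0" for u
        using MB[of "\<tau> + u"] q_add[of u \<tau> \<eta>] that \<eta> \<tau> by simp
      have split_p: "prod_law \<eta> N \<bind> p N t = (prod_law \<eta> N \<bind> p N \<tau>) \<bind> p N ?r"
        using bind_transition_function_add[OF p prod_law_in_prob_algebra[OF \<eta>], of \<tau> ?r] r0 \<tau> by simp
      have split_q: "q ?r ?\<eta>' = q t \<eta>" using q_add[of ?r \<tau> \<eta>] r0 \<tau> \<eta> by simp
      \<comment> \<open>Contractivity with s = \<tau>: the first initial law is the non-product
        particle law at time \<tau>, the second is the product of the limit law there.\<close>
      have "dst N ((prod_law \<eta> N \<bind> p N \<tau>) \<bind> p N ?r) (prod_law ?\<eta>' N \<bind> p N ?r)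
          \<le> C * exp (- lam * ?r) * dst N (prod_law \<eta> N \<bind> p N \<tau>) (prod_law ?\<eta>' N)"
        using contr \<eta> \<eta>' r0 \<tau> N unfolding particle_contractive_def by (simp del: mult_minus_left)
      \<comment> \<open>Passing to \<open>\<bar>C\<bar>\<close> gives the nonnegative factors that
        \<open>mult_mono\<close> asks for, whatever the sign of C.\<close>
      also have "\<dots> \<le> \<bar>C\<bar> * exp (- lam * \<tau>) ^ n * (real N powr (- \<alpha>) * B)"
      proof (intro mult_mono)
        have "exp (- lam * ?r) \<le> exp (real n * (- lam * \<tau>))"
          using mult_left_mono[OF less_imp_le[OF r(1)], of lam] lam by (simp add: mult_ac)
        then show "exp (- lam * ?r) \<le> exp (- lam * \<tau>) ^ n"
          by (simp only: exp_of_nat_mult)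
        show "dst N (prod_law \<eta> N \<bind> p N \<tau>) (prod_law ?\<eta>' N) \<le> real N powr (- \<alpha>) * B"
          using short[OF \<eta> MB] \<tau> by simp
      qed auto
      finally have error: "dst N ((prod_law \<eta> N \<bind> p N \<tau>) \<bind> p N ?r) (prod_law ?\<eta>' N \<bind> p N ?r)
          \<le> \<bar>C\<bar> * exp (- lam * \<tau>) ^ n * (real N powr (- \<alpha>) * B)" .
      \<comment> \<open>The intermediate law is the particle system restarted at \<tau> from i.i.d.
        copies of the limit. The first distance adds the term of index n to the series, the second
        is left to the induction hypothesis.\<close>
      have "dst N (prod_law \<eta> N \<bind> p N t) (prod_law (q t \<eta>) N)
          \<le> dst N ((prod_law \<eta> N \<bind> p N \<tau>) \<bind> p N ?r) (prod_law ?\<eta>' N \<bind> p N ?r)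
            + dst N (prod_law ?\<eta>' N \<bind> p N ?r) (prod_law (q ?r ?\<eta>') N)"
        unfolding split_p split_q[symmetric]
        using r0 \<tau> \<eta> \<eta>' by (intro triangle step_in prod_law_in_prob_algebra q_in) auto
      also have "\<dots> \<le> \<bar>C\<bar> * exp (- lam * \<tau>) ^ n * (real N powr (- \<alpha>) * B)
            + real N powr (- \<alpha>) * B * (1 + \<bar>C\<bar> * ?S n)"
        using r0 r(2) by (intro add_mono error Suc.IH \<eta>' MB') auto
      also have "\<dots> = real N powr (- \<alpha>) * B * (1 + \<bar>C\<bar> * ?S (Suc n))"
        by (simp add: algebra_simps)
      finally show ?thesis .
    qed
  qed
qed

text \<open>Choosing K before all other data, with \<tau> alone fixed, expresses that the constant
  depends only on \<tau>, \<open>lam\<close>, \<open>C\<close> and \<open>Cbd \<nu>\<close>, in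
  particular not on N or t.\<close>

theorem theorem4p1:
  fixes \<tau> :: real
  assumes "\<tau> > 0"
  shows "\<exists>K :: real \<Rightarrow> real \<Rightarrow> real \<Rightarrow> real.
    \<forall>(p :: nat \<Rightarrow> real \<Rightarrow> (nat \<Rightarrow> real ^ 'd) \<Rightarrow> (nat \<Rightarrow> real ^ 'd) measure)
     (q :: real \<Rightarrow> (real ^ 'd) measure \<Rightarrow> (real ^ 'd) measure)
     (dst :: nat \<Rightarrow> (nat \<Rightarrow> real ^ 'd) measure \<Rightarrow> (nat \<Rightarrow> real ^ 'd) measure \<Rightarrow> real)
     (lam :: real) (C :: real) (\<alpha> :: real)
     (M :: (real ^ 'd) measure \<Rightarrow> real) (Cbd :: (real ^ 'd) measure \<Rightarrow> real).
      (\<forall>N\<ge>1. transition_function (conf_space N) (p N)) \<longrightarrow>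
      nonlinear_evolution borel q \<longrightarrow>
      (\<forall>N\<ge>1. Metric_space (space (prob_algebra (conf_space N))) (dst N)) \<longrightarrow>
      lam > 0 \<longrightarrow> particle_contractive p dst lam C \<longrightarrow>
      \<alpha> > 0 \<longrightarrow> (\<forall>\<nu>\<in>space (prob_algebra borel). 0 \<le> M \<nu>) \<longrightarrow>
      finite_time_chaos p q dst \<tau> \<alpha> M \<longrightarrow>
      (\<forall>\<nu>\<in>space (prob_algebra borel). \<forall>t\<ge>0. M (q t \<nu>) \<le> Cbd \<nu>) \<longrightarrow>
      (\<forall>\<nu>\<in>space (prob_algebra borel).
         K lam C (Cbd \<nu>) > 0 \<and>
         (\<forall>t\<ge>0. \<forall>N\<ge>1.
            dst N (prod_law (q t \<nu>) N) (prod_law \<nu> N \<bind> p N t)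
              \<le> K lam C (Cbd \<nu>) * real N powr (- \<alpha>)))"
proof -
  \<comment> \<open>The full geometric series replaces its partial sums, which removes t. The
    summand 1 makes K positive even when B = 0.\<close>
  define K where "K lam C B = \<bar>B\<bar> * (1 + \<bar>C\<bar> / (1 - exp (- lam * \<tau>))) + 1" for lam C B :: real
  show ?thesis
  proof (intro exI[of _ K] allI impI ballI conjI)
    fix p :: "nat \<Rightarrow> real \<Rightarrow> (nat \<Rightarrow> real ^ 'd) \<Rightarrow> (nat \<Rightarrow> real ^ 'd) measure"
      and q dst M Cbd and lam C \<alpha> :: real and \<nu> :: "(real ^ 'd) measure"
    assume p: "\<forall>N\<ge>1. transition_function (conf_space N) (p N)"
      and q: "nonlinear_evolution borel q"
      and dst: "\<forall>N\<ge>1. Metric_space (space (prob_algebra (conf_space N))) (dst N)"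
      and lam: "lam > 0" and contr: "particle_contractive p dst lam C"
      and chaos: "finite_time_chaos p q dst \<tau> \<alpha> M"
      and Cbd: "\<forall>\<nu>\<in>space (prob_algebra borel). \<forall>t\<ge>0. M (q t \<nu>) \<le> Cbd \<nu>"
      and \<nu>: "\<nu> \<in> space (prob_algebra borel)"
    define x where "x = exp (- lam * \<tau>)"
    have x: "0 \<le> x" "x < 1" using lam assms by (simp_all add: x_def)
    show "K lam C (Cbd \<nu>) > 0"
      unfolding K_def x_def[symmetric]
      using x by (intro add_nonneg_pos mult_nonneg_nonneg add_nonneg_nonneg) auto
    fix t :: real and N :: nat
    assume t: "t \<ge> 0" and N: "N \<ge> 1"
    interpret Metric_space "space (prob_algebra (conf_space N))" "dst N" using dst N by simp
    \<comment> \<open>The number of steps depends on t, but enters only through a partial sum of the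
      series.\<close>
    obtain n where "t / \<tau> \<le> real n" using real_arch_simple by blast
    then have tn: "t \<le> real (Suc n) * \<tau>" using assms by (simp add: field_simps)
    have "(\<Sum>i<n. x ^ i) \<le> (\<Sum>i. x ^ i)"
      using x by (intro sum_le_suminf summable_geometric) auto
    also have "\<dots> = 1 / (1 - x)" using x by (intro suminf_geometric) auto
    finally have geo: "1 + \<bar>C\<bar> * (\<Sum>i<n. x ^ i) \<le> 1 + \<bar>C\<bar> / (1 - x)"
      using mult_left_mono[of _ "1 / (1 - x)" "\<bar>C\<bar>"] by simp
    have "dst N (prod_law (q t \<nu>) N) (prod_law \<nu> N \<bind> p N t)
        \<le> real N powr (- \<alpha>) * Cbd \<nu> * (1 + \<bar>C\<bar> * (\<Sum>i<n. x ^ i))"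
      using chaos_by_telescoping[OF assms lam N _ q _ contr chaos \<nu> _ t tn, of "Cbd \<nu>"] p dst Cbd \<nu> N
      by (simp add: x_def commute)
    \<comment> \<open>The absolute value of \<open>Cbd \<nu>\<close> makes the product monotone in
      the last factor.\<close>
    also have "\<dots> \<le> real N powr (- \<alpha>) * \<bar>Cbd \<nu>\<bar> * (1 + \<bar>C\<bar> / (1 - x))"
      using geo x by (intro mult_mono mult_left_mono mult_nonneg_nonneg add_nonneg_nonneg sum_nonneg) auto
    also have "\<dots> \<le> K lam C (Cbd \<nu>) * real N powr (- \<alpha>)"
      unfolding K_def x_def[symmetric] by (simp add: algebra_simps)
    finally show "dst N (prod_law (q t \<nu>) N) (prod_law \<nu> N \<bind> p N t)
        \<le> K lam C (Cbd \<nu>) * real N powr (- \<alpha>)" .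
  qed
qed

end
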